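(* Let $k$ and $n$ be non-negative integers. Let $p$ be a prime with $p\equiv 2\pmod 3$. Then for any integer $j\not\equiv 0\pmod p$, $$B_5\left(p^{2k+2}n+p^{2k+1}j+\frac{p^{2k+2}-1}{3}\right)\equiv 0\pmod 5.$$
   Context: A partition is called $5$-regular if none of its parts is divisible by $5$. $B_5(n)$ denotes the number of ordered pairs $(\lambda,\mu)$ of $5$-regular partitions such that the sum of all parts of $\lambda$ and $\mu$ equals $n$ (so $B_5(0)=1$); equivalently $\sum_{n\ge 0}B_5(n)q^n=\prod_{k\ge1}\frac{(1-q^{5k})^2}{(1-q^k)^2}$. By convention $B_5(n)=0$ for negative integers $n$. *)

theory Defs
  imports "HOL-Library.Multiset" "HOL-Number_Theory.Cong"
    "HOL-Computational_Algebra.Primes"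
begin

text \<open>A partition is represented by the multiset of its parts.\<close>

definition is_partition :: "nat multiset \<Rightarrow> bool" where
  "is_partition L \<longleftrightarrow> (\<forall>x\<in>#L. x > 0)"

definition regular_partition :: "nat \<Rightarrow> nat multiset \<Rightarrow> bool" where
  "regular_partition l L \<longleftrightarrow> is_partition L \<and> (\<forall>x\<in>#L. \<not> l dvd x)"

definition B5_pairs :: "int \<Rightarrow> (nat multiset \<times> nat multiset) set" where
  "B5_pairs n = {(L, M). regular_partition 5 L \<and> regular_partition 5 M \<and>
     int (sum_mset L + sum_mset M) = n}"

definition B5 :: "int \<Rightarrow> nat" where
  "B5 n = card (B5_pairs n)"

text \<open>
  The argument is an integer; for negative arguments no pair qualifies, so the convention
  \<open>B5 n = 0\<close> for \<open>n < 0\<close> is built in. The sets being counted are finite, so that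
  \<open>card\<close> is the true number of pairs.
\<close>

lemma is_partition_size_le: "is_partition L \<Longrightarrow> size L \<le> sum_mset L"
proof (induction L)
  case (add x L)
  hence "x > 0" "size L \<le> sum_mset L"
    by (auto simp: is_partition_def)
  thus ?case by simp
qed simp

lemma finite_partitions_le: "finite {L. is_partition L \<and> sum_mset L \<le> m}"
proof (rule finite_subset)
  show "{L. is_partition L \<and> sum_mset L \<le> m} \<subseteq>
      mset ` {xs. set xs \<subseteq> {..m} \<and> length xs \<le> m}"
  proof
    fix L assume L: "L \<in> {L. is_partition L \<and> sum_mset L \<le> m}"
    obtain xs where xs: "L = mset xs" by (metis ex_mset)
    have "x \<le> m" if "x \<in># L" for x
    proof -
      have "L = add_mset x (L - {#x#})"
        using that by simp
      hence "sum_mset L = x + sum_mset (L - {#x#})"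
        by (metis sum_mset.add_mset)
      thus ?thesis using L by simp
    qed
    moreover have "size L \<le> m"
      using L is_partition_size_le[of L] by simp
    ultimately show "L \<in> mset ` {xs. set xs \<subseteq> {..m} \<and> length xs \<le> m}"
      using xs by auto
  qed
  show "finite (mset ` {xs. set xs \<subseteq> {..m} \<and> length xs \<le> m})"
    by (intro finite_imageI finite_lists_length_le) auto
qed

lemma finite_B5_pairs: "finite (B5_pairs n)"
proof (rule finite_subset)
  let ?P = "{L. is_partition L \<and> sum_mset L \<le> nat n}"
  show "B5_pairs n \<subseteq> ?P \<times> ?P"
  proof
    fix x assume "x \<in> B5_pairs n"
    then obtain L M where x: "x = (L, M)" and part: "is_partition L" "is_partition M"
      and "int (sum_mset L + sum_mset M) = n"
      unfolding B5_pairs_def regular_partition_def by blast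
    hence "sum_mset L \<le> nat n" "sum_mset M \<le> nat n" by linarith+
    thus "x \<in> ?P \<times> ?P"
      using part x by blast
  qed
  show "finite (?P \<times> ?P)"
    by (intro finite_cartesian_product finite_partitions_le)
qed

lemma B5_neg:
  assumes "n < 0"
  shows "B5 n = 0"
proof -
  have "int (sum_mset L + sum_mset M) \<noteq> n" for L M
    using assms by linarith
  hence "B5_pairs n = {}"
    unfolding B5_pairs_def by blast
  thus ?thesis by (simp only: B5_def card.empty)
qed

lemma B5_0: "B5 0 = 1"
proof -
  have *: "L = {#}" if "is_partition L" "sum_mset L = 0" for L
  proof -
    have "size L = 0"
      using is_partition_size_le[OF that(1)] that(2) by linarith
    thus ?thesis by (simp only: size_eq_0_iff_empty)
  qed
  have "B5_pairs 0 = {({#}, {#})}" (is "?A = ?B")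
  proof
    show "?B \<subseteq> ?A"
      by (simp add: B5_pairs_def regular_partition_def is_partition_def)
    show "?A \<subseteq> ?B"
    proof
      fix x assume "x \<in> ?A"
      then obtain L M where x: "x = (L, M)" and part: "is_partition L" "is_partition M"
        and "int (sum_mset L + sum_mset M) = 0"
        unfolding B5_pairs_def regular_partition_def by blast
      hence "sum_mset L = 0" "sum_mset M = 0" by linarith+
      thus "x \<in> ?B"
        using part * x by blast
    qed
  qed
  thus ?thesis by (simp add: B5_def)
qed

end

theory Submission
  imports Defs "HOL-Computational_Algebra.Formal_Power_Series"
    "HOL-Computational_Algebra.Polynomial" "HOL-Number_Theory.Residues"
begin

text \<open>
  Write \<open>f(q) = \<Prod>(1 - q^k)\<close>. Modulo 5 we have \<open>f(q^5) = f(q)^5\<close>, so the generating function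
  \<open>(f(q^5) / f(q))\<^sup>2\<close> of \<open>B5\<close> is congruent to \<open>f\<^sup>8\<close>. By the Macdonald identity of type
  \<open>A\<^sub>2\<close>, the coefficient of \<open>q^N\<close> in \<open>f\<^sup>8\<close> is a weighted sum over the
  representations \<open>3 N + 1 = u\<^sup>2 - u v + v\<^sup>2\<close>. A prime \<open>p \<equiv> 2 (mod 3)\<close> divides
  the values of this form to an even power only, while it divides \<open>3 N + 1\<close> exactly
  \<open>2 k + 1\<close> times for the arguments \<open>N\<close> of the theorem.

  The identity is obtained by cubing Jacobi's series
  \<open>f\<^sup>3 = \<Sum> (-1)\<^sup>a a q^(a (a + 1) / 2)\<close>, \<open>a \<in> \<int>\<close>. In the resulting sum over
  \<open>(a, b, c)\<close> the weight \<open>2 a b c\<close> may be replaced by \<open>(a + c)\<^sup>2 (b + c)\<close>, because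
  monomials that omit one of the variables contribute a factor
  \<open>\<Sum> (-1)\<^sup>a q^(a (a + 1) / 2) = 0\<close>. For fixed \<open>m = a + c\<close> and \<open>n = b + c\<close> the sum
  over \<open>c\<close> either vanishes or is a power of \<open>q\<close> times Euler's pentagonal series for \<open>f\<close>, which
  cancels one factor of \<open>f\<^sup>9\<close>.
\<close>

unbundle fps_syntax

subsection \<open>Truncated power series\<close>

definition eq_upto :: "nat \<Rightarrow> int fps \<Rightarrow> int fps \<Rightarrow> bool" where
  "eq_upto n f g \<longleftrightarrow> (\<forall>i\<le>n. f $ i = g $ i)"

lemma eq_upto_refl [simp]: "eq_upto n f f"
  by (simp add: eq_upto_def)

lemma eq_upto_sym: "eq_upto n f g \<Longrightarrow> eq_upto n g f"
  by (simp add: eq_upto_def)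

lemma eq_upto_trans: "eq_upto n f g \<Longrightarrow> eq_upto n g h \<Longrightarrow> eq_upto n f h"
  by (simp add: eq_upto_def)

lemma eq_upto_mult:
  "eq_upto n f g \<Longrightarrow> eq_upto n f' g' \<Longrightarrow> eq_upto n (f * f') (g * g')"
  by (simp add: eq_upto_def fps_mult_nth)

lemma eq_upto_power: "eq_upto n f g \<Longrightarrow> eq_upto n (f ^ k) (g ^ k)"
  by (induction k) (simp_all add: eq_upto_mult)

lemma eq_upto_sum:
  "(\<And>x. x \<in> A \<Longrightarrow> eq_upto n (f x) (g x)) \<Longrightarrow> eq_upto n (sum f A) (sum g A)"
  by (simp add: eq_upto_def fps_sum_nth)

text \<open>The factor \<open>fps_X ^ t\<close> raises the order of agreement by \<open>t\<close>.
  In \<open>euler_poly_cube\<close> this makes up for the weak approximation of the outer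
  q-binomials.\<close>

lemma eq_upto_shift:
  "eq_upto m f g \<Longrightarrow> n \<le> t + m \<Longrightarrow> eq_upto n (fps_X ^ t * f) (fps_X ^ t * g)"
  by (auto simp: eq_upto_def fps_X_power_mult_nth)

text \<open>A series with nonzero constant term has subdegree 0, so multiplying \<open>f - g\<close>
  by \<open>u\<close> does not change its subdegree.\<close>

lemma eq_upto_cancel:
  assumes "eq_upto n (f * u) (g * u)" "u $ 0 \<noteq> 0"
  shows "eq_upto n f g"
proof (cases "f = g")
  case False
  hence ne: "f - g \<noteq> 0" by simp
  have u: "u \<noteq> 0" using assms(2) by auto
  have "((f - g) * u) $ i = 0" if "i \<le> n" for i
    using assms(1) that by (simp add: eq_upto_def left_diff_distrib)
  hence "n < subdegree ((f - g) * u)"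
    using ne u by (intro subdegree_greaterI) auto
  also have "\<dots> = subdegree (f - g)"
    using ne u assms(2) by (simp add: subdegree_eq_0_iff)
  finally have "(f - g) $ i = 0" if "i \<le> n" for i
    using that by (intro nth_less_subdegree_zero) simp
  thus ?thesis by (simp add: eq_upto_def)
qed simp

section \<open>Euler's product as a limit of its partial products\<close>

definition euler_poly :: "nat \<Rightarrow> int fps" where
  "euler_poly n = (\<Prod>i=1..n. 1 - fps_X ^ i)"

text \<open>This is the infinite product: the coefficient of \<open>q^n\<close> is stable once the
  factors up to \<open>1 - q^n\<close> are included.\<close>

definition euler_fps :: "int fps" where
  "euler_fps = Abs_fps (\<lambda>n. euler_poly n $ n)"

lemma euler_poly_0 [simp]: "euler_poly 0 = 1"
  by (simp add: euler_poly_def)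

lemma euler_poly_Suc: "euler_poly (Suc n) = euler_poly n * (1 - fps_X ^ Suc n)"
  by (simp add: euler_poly_def)

lemma euler_poly_nth_0 [simp]: "euler_poly n $ 0 = 1"
  by (induction n) (simp_all add: euler_poly_Suc)

lemma eq_upto_euler_poly: "n \<le> m \<Longrightarrow> eq_upto n (euler_poly m) (euler_poly n)"
proof (induction m rule: dec_induct)
  case (step m)
  have "eq_upto n (1 - fps_X ^ Suc m) 1"
    using step by (auto simp: eq_upto_def)
  from eq_upto_mult[OF step.IH this] show ?case
    by (simp add: euler_poly_Suc)
qed simp

lemma eq_upto_euler_fps: "n \<le> m \<Longrightarrow> eq_upto n euler_fps (euler_poly m)"
  using eq_upto_sym[OF eq_upto_euler_poly]
  by (fastforce simp: eq_upto_def euler_fps_def)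

lemma euler_fps_nth_0 [simp]: "euler_fps $ 0 = 1"
  by (simp add: euler_fps_def)

lemma euler_fps_nonzero [simp]: "euler_fps \<noteq> 0"
proof
  assume "euler_fps = 0"
  hence "euler_fps $ 0 = 0" by simp
  thus False by simp
qed

subsection \<open>Finite forms of the identities of Jacobi and Euler\<close>

fun qbinom :: "nat \<Rightarrow> nat \<Rightarrow> int fps" where
  "qbinom n 0 = 1"
| "qbinom 0 (Suc k) = 0"
| "qbinom (Suc n) (Suc k) = qbinom n (Suc k) + fps_X ^ (n - k) * qbinom n k"

lemma qbinom_eq_0: "n < k \<Longrightarrow> qbinom n k = 0"
  by (induction n k rule: qbinom.induct) auto

lemma qbinom_refl [simp]: "qbinom n n = 1"
  by (induction n) (simp_all add: qbinom_eq_0)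

text \<open>The q-Pascal recursion keeps \<open>qbinom\<close> inside \<open>int fps\<close>; this
  is the usual quotient formula with denominators cleared. The induction rests on 1 - q^(n+1) = (1 -
  q^(n-k)) + q^(n-k) (1 - q^(k+1)).\<close>

lemma qbinom_euler_poly:
  "k \<le> n \<Longrightarrow> qbinom n k * euler_poly k * euler_poly (n - k) = euler_poly n"
proof (induction n k rule: qbinom.induct)
  case (3 n k)
  show ?case
  proof (cases "k = n")
    case False
    with "3.prems" have kn: "k < n" by simp
    then obtain d where d: "n - k = Suc d" "n - Suc k = d"
      by (metis Suc_diff_Suc)
    have n: "n = k + Suc d" using d kn by simp
    have a: "qbinom n (Suc k) * euler_poly (Suc k) * euler_poly d = euler_poly n"
      and b: "qbinom n k * euler_poly k * euler_poly (Suc d) = euler_poly n"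
      using "3.IH" kn d by simp_all
    have "qbinom (Suc n) (Suc k) * euler_poly (Suc k) * euler_poly (Suc n - Suc k) =
        (qbinom n (Suc k) * euler_poly (Suc k) * euler_poly d) * (1 - fps_X ^ Suc d)
        + (fps_X ^ Suc d - fps_X ^ Suc n) * (qbinom n k * euler_poly k * euler_poly (Suc d))"
      by (simp add: d euler_poly_Suc n power_add algebra_simps)
    also have "\<dots> = euler_poly (Suc n)"
      unfolding a b by (simp add: euler_poly_Suc algebra_simps)
    finally show ?thesis .
  qed (simp add: qbinom_eq_0)
qed simp_all

text \<open>The polynomial variable is z, while q = \<open>fps_X\<close> lies in the coefficient
  ring. The new factor z - q^N acts on the coefficients as the recursion of \<open>qbinom\<close>,
  since (k+1 choose 2) + (N-k) = N + (k choose 2).\<close>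

lemma q_binomial_theorem:
  "(\<Prod>i<N. [:- (fps_X ^ i), 1:]) =
     (\<Sum>k\<le>N. Polynomial.monom ((-1) ^ k * fps_X ^ (k choose 2) * qbinom N k) (N - k))"
proof (induction N)
  case (Suc N)
  define c where "c N k = (-1) ^ k * fps_X ^ (k choose 2) * qbinom N k" for N k
  have c0: "c (Suc N) 0 = c N 0" by (simp add: c_def)
  have cSuc: "c (Suc N) (Suc k) = c N (Suc k) - fps_X ^ N * c N k" if "k \<le> N" for k
  proof -
    have "(Suc k choose 2) + (N - k) = N + (k choose 2)"
      using that by (simp add: numeral_2_eq_2)
    hence "(fps_X :: int fps) ^ (Suc k choose 2) * fps_X ^ (N - k) = fps_X ^ N * fps_X ^ (k choose 2)"
      by (metis power_add)
    thus ?thesis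
      unfolding c_def by (simp add: algebra_simps)
  qed
  have "(\<Prod>i<Suc N. [:- (fps_X ^ i), 1:]) = (\<Sum>k\<le>N. Polynomial.monom (c N k) (N - k)) * [:- (fps_X ^ N), 1:]"
    using Suc by (simp add: c_def)
  also have "\<dots> = (\<Sum>k\<le>N. Polynomial.monom (c N k) (N - k) * (Polynomial.monom 1 1 - Polynomial.monom (fps_X ^ N) 0))"
  proof -
    have "[:- (fps_X ^ N), 1:] = Polynomial.monom 1 1 - Polynomial.monom (fps_X ^ N :: int fps) 0"
      by (simp add: monom_Suc monom_0)
    thus ?thesis by (simp only: sum_distrib_right)
  qed
  also have "\<dots> = (\<Sum>k\<le>N. Polynomial.monom (c N k) (Suc N - k)) - (\<Sum>k\<le>N. Polynomial.monom (fps_X ^ N * c N k) (N - k))"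
    by (simp add: right_diff_distrib mult_monom sum_subtractf Suc_diff_le mult.commute)
  also have "(\<Sum>k\<le>N. Polynomial.monom (c N k) (Suc N - k)) = (\<Sum>k\<le>Suc N. Polynomial.monom (c N k) (Suc N - k))"
    by (simp add: c_def qbinom_eq_0)
  also have "\<dots> = Polynomial.monom (c N 0) (Suc N) + (\<Sum>k\<le>N. Polynomial.monom (c N (Suc k)) (N - k))"
    by (subst sum.atMost_Suc_shift) simp
  finally have "(\<Prod>i<Suc N. [:- (fps_X ^ i), 1:]) =
     Polynomial.monom (c (Suc N) 0) (Suc N) + (\<Sum>k\<le>N. Polynomial.monom (c (Suc N) (Suc k)) (N - k))"
    by (simp add: c0 cSuc diff_monom[symmetric] sum_subtractf)
  also have "\<dots> = (\<Sum>k\<le>Suc N. Polynomial.monom (c (Suc N) k) (Suc N - k))"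
    by (subst sum.atMost_Suc_shift) simp
  finally show ?case by (simp add: c_def)
qed (simp add: numeral_2_eq_2)

section \<open>Alternating signs, triangular and pentagonal exponents\<close>

definition alt_sign :: "int \<Rightarrow> int" where
  "alt_sign l = (if even l then 1 else -1)"

lemma alt_sign_0 [simp]: "alt_sign 0 = 1"
  by (simp add: alt_sign_def)

lemma alt_sign_add: "alt_sign (a + b) = alt_sign a * alt_sign b"
  by (simp add: alt_sign_def)

lemma alt_sign_of_nat: "alt_sign (int n) = (-1) ^ n"
  by (simp add: alt_sign_def)

lemma alt_sign_minus [simp]: "alt_sign (- a) = alt_sign a"
  by (simp add: alt_sign_def)

definition tri :: "int \<Rightarrow> nat" where
  "tri l = nat (l * (l + 1) div 2)"

definition pent :: "int \<Rightarrow> nat" where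
  "pent l = nat (l * (3 * l + 1) div 2)"

lemma mult_succ_nonneg:
  fixes l :: int shows "0 \<le> l * (l + 1)"
  by (cases "l \<ge> 0") (auto simp: zero_le_mult_iff)

text \<open>Exponents are compared after doubling and casting to \<open>int\<close>, which avoids
  reasoning about \<open>div\<close> and \<open>nat\<close>.\<close>

lemma two_tri: "2 * int (tri l) = l * (l + 1)"
proof -
  have "even (l * (l + 1))" by simp
  thus ?thesis using mult_succ_nonneg[of l] by (simp add: tri_def)
qed

lemma two_pent: "2 * int (pent l) = l * (3 * l + 1)"
proof -
  have "even (l * (3 * l + 1))" by simp
  moreover have "0 \<le> l * (3 * l + 1)"
    by (cases "l \<ge> 0") (auto simp: zero_le_mult_iff)
  ultimately show ?thesis by (simp add: pent_def)
qed

lemma two_choose_two: "2 * int (k choose 2) = int k * (int k - 1)"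
  by (induction k) (simp_all add: numeral_2_eq_2 algebra_simps)

lemma double_int_eqD: "2 * int a = 2 * int b \<Longrightarrow> a = b"
  by simp

lemma one_choose_two: "Suc 0 choose 2 = 0"
  by (simp add: numeral_2_eq_2)

section \<open>Finite form of Jacobi's identity\<close>

lemma euler_poly_lessThan: "euler_poly n = (\<Prod>i<n. 1 - fps_X ^ Suc i)"
  unfolding euler_poly_def using prod.atLeast1_atMost_eq[of "\<lambda>i. 1 - fps_X ^ i" n] by simp

lemma prod_fps_X_power: "(\<Prod>i<n. fps_X ^ i :: int fps) = fps_X ^ (n choose 2)"
  by (induction n) (simp_all add: numeral_2_eq_2 power_add algebra_simps)

text \<open>Each i < n contributes -q^i (1 - q^(n-i)) and each i > n contributes q^n (1 - q^(i-n));
  the two halves yield one \<open>euler_poly n\<close> each.\<close>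

lemma prod_fps_X_power_diff:
  "(\<Prod>i\<in>{..<2 * n + 1} - {n}. fps_X ^ n - fps_X ^ i :: int fps) =
     (-1) ^ n * fps_X ^ ((n choose 2) + n * n) * euler_poly n ^ 2"
proof -
  have split: "{..<2 * n + 1} - {n} = {..<n} \<union> {Suc n..<Suc n + n}" by auto
  have "(\<Prod>i<n. fps_X ^ n - fps_X ^ i :: int fps) = (\<Prod>i<n. (-1) * fps_X ^ i * (1 - fps_X ^ (n - i)))"
    by (intro prod.cong) (auto simp: right_diff_distrib power_add[symmetric])
  also have "\<dots> = (-1) ^ n * fps_X ^ (n choose 2) * (\<Prod>i<n. 1 - fps_X ^ (n - i))"
    by (simp add: prod.distrib prod_fps_X_power del: mult_minus1 mult_minus_left)
  also have "(\<Prod>i<n. 1 - fps_X ^ (n - i) :: int fps) = euler_poly n"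
    using prod.nat_diff_reindex[of "\<lambda>i. 1 - fps_X ^ Suc i :: int fps" n]
    by (simp add: euler_poly_lessThan Suc_diff_Suc del: power_Suc)
  finally have 1: "(\<Prod>i<n. fps_X ^ n - fps_X ^ i :: int fps) =
      (-1) ^ n * fps_X ^ (n choose 2) * euler_poly n" .
  have "(\<Prod>i\<in>{Suc n..<Suc n + n}. fps_X ^ n - fps_X ^ i :: int fps) =
      (\<Prod>i<n. fps_X ^ n - fps_X ^ (Suc n + i))"
    using prod.atLeastLessThan_shift_0[of "\<lambda>i. fps_X ^ n - fps_X ^ i :: int fps" "Suc n" "Suc n + n"]
    by (simp add: lessThan_atLeast0 add.commute)
  also have "\<dots> = (\<Prod>i<n. fps_X ^ n * (1 - fps_X ^ Suc i))"
    by (simp add: right_diff_distrib power_add mult_ac)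
  also have "\<dots> = fps_X ^ (n * n) * euler_poly n"
    by (simp add: prod.distrib euler_poly_lessThan power_mult)
  finally have 2: "(\<Prod>i\<in>{Suc n..<Suc n + n}. fps_X ^ n - fps_X ^ i :: int fps) =
      fps_X ^ (n * n) * euler_poly n" .
  have "(\<Prod>i\<in>{..<n} \<union> {Suc n..<Suc n + n}. fps_X ^ n - fps_X ^ i :: int fps) =
      (\<Prod>i<n. fps_X ^ n - fps_X ^ i) * (\<Prod>i\<in>{Suc n..<Suc n + n}. fps_X ^ n - fps_X ^ i)"
    by (rule prod.union_disjoint) auto
  thus ?thesis
    unfolding split 1 2 by (simp only: power_add power2_eq_square mult_ac)
qed

lemma pderiv_sum': "pderiv (sum f A) = (\<Sum>x\<in>A. pderiv (f x))"
  using higher_pderiv_sum[of 1 f A] by simp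

text \<open>Differentiate the \<open>q\<close>-binomial theorem for \<open>N = 2 n + 1\<close> at the root \<open>q^n\<close>.\<close>

lemma euler_poly_square:
  "euler_poly n ^ 2 = (\<Sum>k\<le>2 * n. fps_X ^ tri (int n - int k) *
     of_int (alt_sign (int n - int k) * (2 * int n + 1 - int k)) * qbinom (2 * n + 1) k)"
    (is "_ = (\<Sum>k\<le>_. ?t k)")
proof -
  let ?C = "(n choose 2) + n * n"
  define c where "c k = (-1) ^ k * fps_X ^ (k choose 2) * qbinom (2 * n + 1) k" for k
  have "(-1) ^ n * fps_X ^ ?C * euler_poly n ^ 2 =
      poly (pderiv (\<Prod>i<2 * n + 1. [:- (fps_X ^ i), 1:])) (fps_X ^ n)"
  proof -
    have "poly (pderiv (\<Prod>i<2 * n + 1. [:- (fps_X ^ i), 1 :: int fps:])) (fps_X ^ n) =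
        (\<Sum>a<2 * n + 1. \<Prod>i\<in>{..<2 * n + 1} - {a}. fps_X ^ n - fps_X ^ i)"
      by (simp add: pderiv_prod poly_sum poly_prod pderiv_pCons del: prod.lessThan_Suc sum.lessThan_Suc)
    \<comment> \<open>For every other \<open>a\<close> the product still contains the factor with
      \<open>i = n\<close>, which is 0.\<close>
    also have "\<dots> = (\<Sum>a\<in>{n}. \<Prod>i\<in>{..<2 * n + 1} - {a}. fps_X ^ n - fps_X ^ i)"
    proof (intro sum.mono_neutral_right ballI)
      fix a assume "a \<in> {..<2 * n + 1} - {n}"
      thus "(\<Prod>i\<in>{..<2 * n + 1} - {a}. fps_X ^ n - fps_X ^ i :: int fps) = 0"
        by (intro prod_zero) auto
    qed auto
    finally show ?thesis
      unfolding prod_fps_X_power_diff[symmetric]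
      by (simp only: sum.insert finite.emptyI sum.empty empty_iff not_False_eq_True add_0_right)
  qed
  also have "\<dots> = (\<Sum>k\<le>2 * n + 1. of_nat (2 * n + 1 - k) * c k * fps_X ^ (n * (2 * n - k)))"
    unfolding q_binomial_theorem
    by (simp add: pderiv_sum' pderiv_monom poly_sum poly_monom c_def power_mult
        del: sum.atMost_Suc)
  \<comment> \<open>The term \<open>k = 2 * n + 1\<close> carries the weight 0.\<close>
  also have "\<dots> = (\<Sum>k\<le>2 * n. of_nat (2 * n + 1 - k) * c k * fps_X ^ (n * (2 * n - k)))"
    by simp
  also have "\<dots> = (\<Sum>k\<le>2 * n. (-1) ^ n * fps_X ^ ?C * ?t k)"
  proof (intro sum.cong refl)
    fix k assume k: "k \<in> {..2 * n}"
    have "int (2 * n - k) = 2 * int n - int k"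
      using k by (simp add: of_nat_diff)
    \<comment> \<open>In terms of l = n - k the exponent is the constant \<open>?C\<close> plus
      \<open>tri l\<close>, so \<open>?C\<close> can be cancelled from all terms.\<close>
    hence "2 * int ((k choose 2) + n * (2 * n - k)) = 2 * int (?C + tri (int n - int k))"
      unfolding of_nat_add of_nat_mult[of n] distrib_left two_choose_two two_tri
      by (simp add: algebra_simps)
    hence "(k choose 2) + n * (2 * n - k) = ?C + tri (int n - int k)"
      by (rule double_int_eqD)
    hence e: "(fps_X :: int fps) ^ (k choose 2) * fps_X ^ (n * (2 * n - k)) =
        fps_X ^ ?C * fps_X ^ tri (int n - int k)"
      by (simp only: power_add[symmetric])
    have s: "(-1) ^ k = (-1) ^ n * (of_int (alt_sign (int n - int k)) :: int fps)"
      by (simp add: alt_sign_def minus_one_power_iff)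
    have w: "(of_nat (2 * n + 1 - k) :: int fps) = of_int (2 * int n + 1 - int k)"
      using k by (simp add: of_nat_diff)
    have "of_nat (2 * n + 1 - k) * c k * fps_X ^ (n * (2 * n - k)) =
       of_nat (2 * n + 1 - k) * (-1) ^ k * qbinom (2 * n + 1) k *
        (fps_X ^ (k choose 2) * fps_X ^ (n * (2 * n - k)))"
      by (simp add: c_def mult_ac)
    also have "\<dots> = (-1) ^ n * fps_X ^ ?C * ?t k"
      unfolding e s w of_int_mult by (simp only: mult_ac)
    finally show "of_nat (2 * n + 1 - k) * c k * fps_X ^ (n * (2 * n - k)) =
      (-1) ^ n * fps_X ^ ?C * ?t k" .
  qed
  also have "\<dots> = (-1) ^ n * fps_X ^ ?C * (\<Sum>k\<le>2 * n. ?t k)"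
    by (simp add: sum_distrib_left)
  finally show ?thesis by simp
qed

text \<open>In the quotient formula for \<open>qbinom (2 * n + 1) k\<close> all four partial
  products involved have index at least \<open>m\<close>, so up to order \<open>m\<close> they agree
  and cancel.\<close>

lemma qbinom_eq_upto:
  assumes "k \<le> 2 * n" "m = min k (2 * n + 1 - k)"
  shows "eq_upto m (qbinom (2 * n + 1) k * euler_poly n) 1"
proof (rule eq_upto_cancel)
  let ?P = "euler_poly k * euler_poly (2 * n + 1 - k)"
  have "eq_upto m (euler_poly (2 * n + 1) * euler_poly n) (euler_poly m * euler_poly m)"
    using assms by (intro eq_upto_mult eq_upto_euler_poly) auto
  moreover have "eq_upto m (1 * ?P) (euler_poly m * euler_poly m)"
    using assms by (auto intro!: eq_upto_mult eq_upto_euler_poly)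
  moreover have "qbinom (2 * n + 1) k * euler_poly n * ?P = euler_poly (2 * n + 1) * euler_poly n"
    using qbinom_euler_poly[of k "2 * n + 1"] assms(1) by (simp add: mult_ac)
  ultimately show "eq_upto m (qbinom (2 * n + 1) k * euler_poly n * ?P) (1 * ?P)"
    by (metis eq_upto_sym eq_upto_trans)
qed simp

lemma euler_poly_cube:
  "eq_upto n (euler_poly n ^ 3) (\<Sum>k\<le>2 * n. fps_X ^ tri (int n - int k) *
     of_int (alt_sign (int n - int k) * (2 * int n + 1 - int k)))"
proof -
  have "euler_poly n ^ 3 = euler_poly n ^ 2 * euler_poly n"
    by (simp add: numeral_3_eq_3 numeral_2_eq_2)
  also have "\<dots> = (\<Sum>k\<le>2 * n. fps_X ^ tri (int n - int k) *
     (of_int (alt_sign (int n - int k) * (2 * int n + 1 - int k)) * (qbinom (2 * n + 1) k * euler_poly n)))"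
    unfolding euler_poly_square sum_distrib_right by (simp add: mult_ac)
  finally have eq: "euler_poly n ^ 3 = \<dots>" .
  have "eq_upto n (euler_poly n ^ 3) (\<Sum>k\<le>2 * n. fps_X ^ tri (int n - int k) *
     (of_int (alt_sign (int n - int k) * (2 * int n + 1 - int k)) * 1))"
    unfolding eq
  proof (intro eq_upto_sum eq_upto_shift eq_upto_mult eq_upto_refl)
    fix k assume k: "k \<in> {..2 * n}"
    show "eq_upto (min k (2 * n + 1 - k)) (qbinom (2 * n + 1) k * euler_poly n) 1"
      using k by (intro qbinom_eq_upto) auto
    define d where "d = int n - int k"
    have d: "2 * int (tri d) = d * (d + 1)" by (rule two_tri)
    \<comment> \<open>These products are twice the gaps \<open>tri d + k - n\<close> and
      \<open>tri d + (2 * n + 1 - k) - n\<close>, so the shift by \<open>tri d\<close> restores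
      order \<open>n\<close>.\<close>
    have *: "0 \<le> d * (d - 1)" "0 \<le> (d + 1) * (d + 2)"
      using mult_succ_nonneg[of "d - 1"] mult_succ_nonneg[of "d + 1"] by (simp_all add: algebra_simps)
    have "int n \<le> int (tri d) + int k" "int n \<le> int (tri d) + (2 * int n + 1 - int k)"
      using * d by (auto simp: d_def algebra_simps)
    thus "n \<le> tri (int n - int k) + min k (2 * n + 1 - k)"
      using k unfolding d_def by auto
  qed
  thus ?thesis by simp
qed

text \<open>Shanks' finite form of the pentagonal number theorem; the induction step telescopes.\<close>

lemma shanks:
  "(\<Sum>s\<le>n. (-1) ^ s * fps_X ^ (s * n + (Suc s choose 2)) * (\<Prod>i\<in>{s<..n}. 1 - fps_X ^ i)) =
   (\<Sum>k\<in>{- int n..int n}. of_int (alt_sign k) * fps_X ^ pent k :: int fps)"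
proof (induction n)
  case 0
  show ?case by (simp add: pent_def one_choose_two)
next
  case (Suc n)
  define R :: "nat \<Rightarrow> nat \<Rightarrow> int fps" where "R s n = (\<Prod>i\<in>{s<..n}. 1 - fps_X ^ i)" for s n
  define t :: "nat \<Rightarrow> nat \<Rightarrow> int fps"
    where "t n s = (-1) ^ s * fps_X ^ (s * n + (Suc s choose 2)) * R s n" for s n
  \<comment> \<open>\<open>D\<close> is the telescoping certificate: the increments of the summands
    from \<open>n\<close> to \<open>n + 1\<close> are differences of consecutive values of
    \<open>D\<close>.\<close>
  define D :: "nat \<Rightarrow> int fps"
    where "D s = (-1) ^ s * fps_X ^ (Suc s * Suc n + (Suc s choose 2)) * R s n" for s
  have R_Suc: "R s (Suc n) = R s n * (1 - fps_X ^ Suc n)" if "s \<le> n" for s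
  proof -
    have "{s<..Suc n} = insert (Suc n) {s<..n}" using that by auto
    thus ?thesis by (simp add: R_def mult.commute)
  qed
  have R_shift: "R s n = (1 - fps_X ^ Suc s) * R (Suc s) n" if "s < n" for s
  proof -
    have "{s<..n} = insert (Suc s) {Suc s<..n}" using that by auto
    thus ?thesis by (simp add: R_def)
  qed
  have step: "t (Suc n) (Suc s) - t n (Suc s) = D s - D (Suc s)" if "s < n" for s
  proof -
    have e: "Suc s * Suc n + (Suc (Suc s) choose 2) = Suc s * n + (Suc (Suc s) choose 2) + Suc s"
      by simp
    have e': "Suc s * Suc n + (Suc s choose 2) = Suc s * n + (Suc (Suc s) choose 2)"
      by (simp add: numeral_2_eq_2)
    have e'': "Suc (Suc s) * Suc n + (Suc (Suc s) choose 2) = 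
       Suc s * n + (Suc (Suc s) choose 2) + Suc s + Suc n"
      by simp
    show ?thesis
      unfolding t_def D_def R_Suc[OF Suc_leI[OF that]] R_shift[OF that] e e' e'' power_add
      by (simp add: algebra_simps)
  qed
  have tel: "(\<Sum>s\<le>m. t (Suc n) s - t n s) = - D m" if "m \<le> n" for m
    using that
  proof (induction m)
    case 0
    show ?case by (simp add: t_def D_def R_Suc one_choose_two algebra_simps)
  next
    case (Suc m)
    thus ?case using step[of m] by simp
  qed
  have "(\<Sum>s\<le>Suc n. t (Suc n) s) = (\<Sum>s\<le>n. t n s) + (t (Suc n) (Suc n) - D n)"
    using tel[of n] by (simp add: sum_subtractf algebra_simps)
  also have "(\<Sum>s\<le>n. t n s) = (\<Sum>k\<in>{- int n..int n}. of_int (alt_sign k) * fps_X ^ pent k)"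
    using Suc.IH by (simp add: t_def R_def)
  \<comment> \<open>The new top summand and the telescoping remainder are the two new pentagonal
    terms, with indices n + 1 and -(n + 1).\<close>
  also have "t (Suc n) (Suc n) - D n = of_int (alt_sign (int (Suc n))) * fps_X ^ pent (int (Suc n)) +
     of_int (alt_sign (- int (Suc n))) * fps_X ^ pent (- int (Suc n))"
  proof -
    have "2 * int (Suc n * Suc n + (Suc (Suc n) choose 2)) = 2 * int (pent (int (Suc n)))"
      unfolding of_nat_add distrib_left two_choose_two two_pent by (simp add: algebra_simps)
    hence e: "Suc n * Suc n + (Suc (Suc n) choose 2) = pent (int (Suc n))"
      by (rule double_int_eqD)
    have "2 * int (Suc n * Suc n + (Suc n choose 2)) = 2 * int (pent (- int (Suc n)))"
      unfolding of_nat_add distrib_left two_choose_two two_pent by (simp add: algebra_simps)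
    hence e': "Suc n * Suc n + (Suc n choose 2) = pent (- int (Suc n))"
      by (rule double_int_eqD)
    have "R n n = 1" "R (Suc n) (Suc n) = 1" by (simp_all add: R_def)
    thus ?thesis
      unfolding t_def D_def e e' alt_sign_minus alt_sign_of_nat by simp
  qed
  also have "(\<Sum>k\<in>{- int n..int n}. of_int (alt_sign k) * fps_X ^ pent k :: int fps) + \<dots> =
     (\<Sum>k\<in>{- int (Suc n)..int (Suc n)}. of_int (alt_sign k) * fps_X ^ pent k)"
  proof -
    have "{- int (Suc n)..int (Suc n)} = insert (- int (Suc n)) (insert (int (Suc n)) {- int n..int n})"
      by auto
    moreover have "- int (Suc n) \<noteq> int (Suc n)" by linarith
    ultimately show ?thesis by (simp add: add_ac)
  qed
  finally show ?case by (simp only: t_def R_def)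
qed

text \<open>In Shanks' sum the term \<open>s = 0\<close> is \<open>euler_poly n\<close>, and every
  term with \<open>s > 0\<close> starts beyond \<open>q^n\<close>.\<close>

lemma euler_poly_pentagonal:
  "eq_upto n (euler_poly n) (\<Sum>k\<in>{- int n..int n}. of_int (alt_sign k) * fps_X ^ pent k)"
proof -
  let ?t = "\<lambda>s. (-1) ^ s * fps_X ^ (s * n + (Suc s choose 2)) * (\<Prod>i\<in>{s<..n}. 1 - fps_X ^ i) :: int fps"
  have "eq_upto n (?t s) 0" if "s \<noteq> 0" for s
  proof -
    obtain r where s: "s = Suc r" using \<open>s \<noteq> 0\<close> by (cases s) auto
    have "n < s * n + (Suc s choose 2)"
      using s by (simp add: numeral_2_eq_2)
    hence "eq_upto n (fps_X ^ (s * n + (Suc s choose 2))) 0"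
      by (auto simp: eq_upto_def)
    from eq_upto_mult[OF eq_upto_mult[OF eq_upto_refl this] eq_upto_refl] show ?thesis
      by simp
  qed
  hence "eq_upto n (\<Sum>s\<le>n. ?t s) (\<Sum>s\<le>n. if s = 0 then ?t s else 0)"
    by (intro eq_upto_sum) auto
  moreover have "{0<..n} = {1..n}" by auto
  ultimately have "eq_upto n (\<Sum>k\<in>{- int n..int n}. of_int (alt_sign k) * fps_X ^ pent k)
      (euler_poly n)"
    by (simp add: shanks euler_poly_def one_choose_two)
  thus ?thesis by (rule eq_upto_sym)
qed

subsection \<open>Weighted generating functions\<close>

text \<open>Only meaningful when the fibres of \<open>e\<close> are finite, as the sum is 0 over infinite sets.\<close>

definition wgf :: "'i set \<Rightarrow> ('i \<Rightarrow> nat) \<Rightarrow> ('i \<Rightarrow> int) \<Rightarrow> int fps" where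
  "wgf S e w = Abs_fps (\<lambda>N. \<Sum>i | i \<in> S \<and> e i = N. w i)"

definition finite_fibres :: "'i set \<Rightarrow> ('i \<Rightarrow> nat) \<Rightarrow> bool" where
  "finite_fibres S e \<longleftrightarrow> (\<forall>N. finite {i \<in> S. e i = N})"

lemma wgf_nth: "wgf S e w $ N = (\<Sum>i | i \<in> S \<and> e i = N. w i)"
  by (simp add: wgf_def)

lemma wgf_add: "wgf S e (\<lambda>i. w i + w' i) = wgf S e w + wgf S e w'"
  by (simp add: fps_eq_iff wgf_nth sum.distrib)

lemma wgf_cmult: "wgf S e (\<lambda>i. c * w i) = of_int c * wgf S e w"
  by (simp add: fps_eq_iff wgf_nth sum_distrib_left fps_of_int[symmetric])

lemma fibres_prod:
  fixes e :: "'i \<Rightarrow> nat" and f :: "'j \<Rightarrow> nat"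
  shows "{x \<in> S \<times> T. (case x of (i, j) \<Rightarrow> e i + f j) = N} =
   (\<Union>k\<in>{0..N}. {i \<in> S. e i = k} \<times> {j \<in> T. f j = N - k})"
  by auto

lemma finite_fibres_prod:
  assumes "finite_fibres S e" "finite_fibres T f"
  shows "finite_fibres (S \<times> T) (\<lambda>(i, j). e i + f j)"
  using assms unfolding finite_fibres_def fibres_prod by auto

lemma wgf_mult:
  assumes "finite_fibres S e" "finite_fibres T f"
  shows "wgf S e w * wgf T f v = wgf (S \<times> T) (\<lambda>(i, j). e i + f j) (\<lambda>(i, j). w i * v j)"
proof (rule fps_ext)
  fix N
  have "wgf (S \<times> T) (\<lambda>(i, j). e i + f j) (\<lambda>(i, j). w i * v j) $ N =
     (\<Sum>k=0..N. \<Sum>(i, j)\<in>{i \<in> S. e i = k} \<times> {j \<in> T. f j = N - k}. w i * v j)"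
    unfolding wgf_nth fibres_prod
    using assms by (intro sum.UNION_disjoint) (auto simp: finite_fibres_def)
  also have "\<dots> = (\<Sum>k=0..N. (\<Sum>i | i \<in> S \<and> e i = k. w i) * (\<Sum>j | j \<in> T \<and> f j = N - k. v j))"
    by (simp add: sum_product sum.cartesian_product)
  finally show "(wgf S e w * wgf T f v) $ N =
      wgf (S \<times> T) (\<lambda>(i, j). e i + f j) (\<lambda>(i, j). w i * v j) $ N"
    by (simp add: fps_mult_nth wgf_nth)
qed

lemma wgf_reindex:
  assumes "bij_betw h S T" "\<And>i. i \<in> S \<Longrightarrow> e (h i) = e' i" "\<And>i. i \<in> S \<Longrightarrow> w (h i) = w' i"
  shows "wgf S e' w' = wgf T e w"
proof (rule fps_ext)
  fix N
  have "bij_betw h {i \<in> S. e' i = N} {j \<in> T. e j = N}"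
    using assms(1,2) unfolding bij_betw_def by (auto simp: inj_on_def image_iff)
  hence "(\<Sum>i | i \<in> S \<and> e' i = N. w (h i)) = (\<Sum>j | j \<in> T \<and> e j = N. w j)"
    by (rule sum.reindex_bij_betw)
  thus "wgf S e' w' $ N = wgf T e w $ N"
    unfolding wgf_nth using assms(3) by simp
qed

text \<open>Off \<open>T\<close>, reindexing along \<open>h\<close> shows that each coefficient sum
  equals its own negative.\<close>

lemma wgf_involution:
  assumes "finite_fibres S e" "T \<subseteq> S"
    and "\<And>i. i \<in> S - T \<Longrightarrow> h i \<in> S - T \<and> h (h i) = i \<and> e (h i) = e i \<and> w (h i) = - w i"
  shows "wgf S e w = wgf T e w"
proof (rule fps_ext)
  fix N
  let ?B = "{i \<in> S - T. e i = N}"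
  have "(\<Sum>i\<in>?B. w i) = (\<Sum>i\<in>?B. - w i)"
    using assms(3) by (intro sum.reindex_bij_witness[of _ h h]) auto
  hence "(\<Sum>i\<in>?B. w i) = 0" by (simp add: sum_negf)
  moreover have "{i \<in> S. e i = N} = {i \<in> T. e i = N} \<union> ?B" using assms(2) by auto
  moreover have "finite {i \<in> T. e i = N}" "finite ?B"
    using assms(1,2) by (auto simp: finite_fibres_def intro: rev_finite_subset)
  moreover have "{i \<in> T. e i = N} \<inter> ?B = {}" by auto
  ultimately show "wgf S e w $ N = wgf T e w $ N"
    unfolding wgf_nth by (simp add: sum.union_disjoint)
qed

section \<open>The limiting identities of Euler and Jacobi\<close>

lemma tri_fibre_subset: "{l. tri l = N} \<subseteq> {- int N - 1..int N}"
proof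
  fix l assume "l \<in> {l. tri l = N}"
  hence l: "l * (l + 1) = 2 * int N" using two_tri[of l] by simp
  show "l \<in> {- int N - 1..int N}"
  proof (cases "l \<ge> 0")
    case True
    hence "l * 2 \<le> l * (l + 1)" by (cases "l = 0") (auto intro: mult_left_mono)
    thus ?thesis using l True by simp
  next
    case False
    have "(- l - 1) * 2 \<le> (- l - 1) * (- l)"
      using False mult_left_mono[of 2 "- l" "- l - 1"] by (cases "l = -1") auto
    also have "\<dots> = 2 * int N" using l by (simp add: algebra_simps)
    finally show ?thesis using False by simp
  qed
qed

lemma finite_fibres_tri: "finite_fibres UNIV tri"
  unfolding finite_fibres_def using finite_subset[OF tri_fibre_subset] by simp

lemma pent_fibre_subset: "{l. pent l = N} \<subseteq> {- int N..int N}"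
proof
  fix l assume "l \<in> {l. pent l = N}"
  hence l: "l * (3 * l + 1) = 2 * int N" using two_pent[of l] by simp
  show "l \<in> {- int N..int N}"
  proof (cases "l \<ge> 0")
    case True
    hence "l * 2 \<le> l * (3 * l + 1)" by (cases "l = 0") (auto intro: mult_left_mono)
    thus ?thesis using l True by simp
  next
    case False
    have "(- l) * 2 \<le> (- l) * (- (3 * l + 1))"
      using False by (intro mult_left_mono) auto
    also have "\<dots> = 2 * int N" using l by (simp add: algebra_simps)
    finally show ?thesis using False by simp
  qed
qed

lemma finite_fibres_pent: "finite_fibres UNIV pent"
  unfolding finite_fibres_def using finite_subset[OF pent_fibre_subset] by simp

lemma nth_of_int_mult_X_power:
  "(of_int c * fps_X ^ t :: int fps) $ N = (if t = N then c else 0)"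
  "(fps_X ^ t * of_int c :: int fps) $ N = (if t = N then c else 0)"
  by (auto simp: fps_of_int[symmetric] fps_X_power_mult_right_nth)

lemma euler_pentagonal: "euler_fps = wgf UNIV pent alt_sign"
proof (rule fps_ext)
  fix N
  have "euler_fps $ N = (\<Sum>k\<in>{- int N..int N}. of_int (alt_sign k) * fps_X ^ pent k) $ N"
    using euler_poly_pentagonal[of N] by (simp add: euler_fps_def eq_upto_def)
  also have "\<dots> = (\<Sum>k\<in>{- int N..int N}. if pent k = N then alt_sign k else 0)"
    unfolding fps_sum_nth nth_of_int_mult_X_power ..
  also have "\<dots> = (\<Sum>k | k \<in> {- int N..int N} \<and> pent k = N. alt_sign k)"
    by (simp only: sum.inter_filter finite_atLeastAtMost_int)
  also have "{k. k \<in> {- int N..int N} \<and> pent k = N} = {k. k \<in> UNIV \<and> pent k = N}"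
    using pent_fibre_subset[of N] by auto
  finally show "euler_fps $ N = wgf UNIV pent alt_sign $ N"
    by (simp only: wgf_nth)
qed

lemma tri_reflect: "tri (- 1 - l) = tri l"
  by (simp add: tri_def algebra_simps)

text \<open>The reflection l -> -1 - l preserves the exponent and flips the parity.\<close>

lemma wgf_tri_alt_sign: "wgf UNIV tri alt_sign = 0"
proof -
  have "wgf UNIV tri alt_sign = wgf {} tri alt_sign"
    by (rule wgf_involution[where h = "\<lambda>l. - 1 - l", OF finite_fibres_tri])
       (auto simp: tri_reflect alt_sign_def)
  thus ?thesis by (simp add: fps_eq_iff wgf_nth)
qed

text \<open>The finite form gives the weight N + 1 + l instead of l; the part N + 1 multiplies the
  vanishing series of \<open>wgf_tri_alt_sign\<close>.\<close>

lemma jacobi_cube: "euler_fps ^ 3 = wgf UNIV tri (\<lambda>l. alt_sign l * l)"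
proof (rule fps_ext)
  fix N
  let ?w = "\<lambda>l. alt_sign l * (int N + 1 + l)"
  have "(euler_fps ^ 3) $ N = (euler_poly N ^ 3) $ N"
    using eq_upto_power[OF eq_upto_euler_fps[of N N], of 3] by (simp add: eq_upto_def)
  also have "\<dots> = (\<Sum>k\<le>2 * N. fps_X ^ tri (int N - int k) *
     of_int (alt_sign (int N - int k) * (2 * int N + 1 - int k))) $ N"
    using euler_poly_cube[of N] by (simp add: eq_upto_def)
  also have "\<dots> = (\<Sum>k\<le>2 * N. if tri (int N - int k) = N
      then alt_sign (int N - int k) * (2 * int N + 1 - int k) else 0)"
    unfolding fps_sum_nth nth_of_int_mult_X_power ..
  also have "\<dots> = (\<Sum>l\<in>{- int N..int N}. if tri l = N then ?w l else 0)"
    by (rule sum.reindex_bij_witness[of _ "\<lambda>l. nat (int N - l)" "\<lambda>k. int N - int k"])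
       (auto simp: algebra_simps)
  \<comment> \<open>The index l = -N - 1 is missing from the finite form but may lie in the fibre;
    its weight N + 1 + l is 0.\<close>
  also have "\<dots> = (\<Sum>l\<in>{- int N - 1..int N}. if tri l = N then ?w l else 0)"
  proof (rule sum.mono_neutral_left)
    have "l = - int N - 1" if "l \<in> {- int N - 1..int N} - {- int N..int N}" for l
      using that by auto
    thus "\<forall>l\<in>{- int N - 1..int N} - {- int N..int N}. (if tri l = N then ?w l else 0) = 0"
      by force
  qed auto
  also have "\<dots> = (\<Sum>l | l \<in> {- int N - 1..int N} \<and> tri l = N. ?w l)"
    by (simp only: sum.inter_filter finite_atLeastAtMost_int)
  also have "{l. l \<in> {- int N - 1..int N} \<and> tri l = N} = {l. l \<in> UNIV \<and> tri l = N}"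
    using tri_fibre_subset[of N] by auto
  also have "(\<Sum>l | l \<in> UNIV \<and> tri l = N. ?w l) =
      wgf UNIV tri (\<lambda>l. (int N + 1) * alt_sign l + alt_sign l * l) $ N"
    by (simp add: wgf_nth algebra_simps)
  also have "\<dots> = wgf UNIV tri (\<lambda>l. alt_sign l * l) $ N"
    unfolding wgf_add wgf_cmult wgf_tri_alt_sign by simp
  finally show "(euler_fps ^ 3) $ N = wgf UNIV tri (\<lambda>l. alt_sign l * l) $ N" .
qed

subsection \<open>The eighth power of the Euler product\<close>

definition tri3 :: "(int \<times> int) \<times> int \<Rightarrow> nat" where
  "tri3 = (\<lambda>(x, c). (\<lambda>(a, b). tri a + tri b) x + tri c)"

lemma finite_fibres_tri3: "finite_fibres UNIV tri3"
  using finite_fibres_prod[OF finite_fibres_prod[OF finite_fibres_tri finite_fibres_tri] finite_fibres_tri]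
  by (simp add: tri3_def)

lemma wgf_tri3_mult:
  "wgf UNIV tri f * wgf UNIV tri g * wgf UNIV tri h =
     wgf UNIV tri3 (\<lambda>((a, b), c). f a * g b * h c)"
  using finite_fibres_prod[OF finite_fibres_tri finite_fibres_tri]
  by (simp add: wgf_mult finite_fibres_tri tri3_def case_prod_unfold)

text \<open>The weight depends only on a + c and b + c, so it stays constant in the later summation
  over c. Among its monomials only 2 a b c involves all three variables.\<close>

lemma euler_ninth_power:
  "2 * euler_fps ^ 9 =
     wgf UNIV tri3 (\<lambda>((a, b), c). alt_sign (a + b + c) * ((a + c)\<^sup>2 * (b + c)))"
proof -
  let ?A = "\<lambda>i::nat. wgf UNIV tri (\<lambda>l. alt_sign l * l ^ i)"
  let ?m = "\<lambda>i j k. \<lambda>((a, b), c). (alt_sign a * a ^ i) * (alt_sign b * b ^ j) * (alt_sign c * c ^ k)"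
  let ?W = "\<lambda>i j k. wgf UNIV tri3 (?m i j k)"
  have A0: "?A 0 = 0" by (simp add: wgf_tri_alt_sign)
  have "(\<lambda>((a, b), c). alt_sign (a + b + c) * ((a + c)\<^sup>2 * (b + c))) =
    (\<lambda>x. ?m 2 1 0 x + (?m 2 0 1 x + (2 * ?m 1 1 1 x + (2 * ?m 1 0 2 x + (?m 0 1 2 x + ?m 0 0 3 x)))))"
    by (auto simp: fun_eq_iff alt_sign_add power2_eq_square power3_eq_cube algebra_simps)
  hence "wgf UNIV tri3 (\<lambda>((a, b), c). alt_sign (a + b + c) * ((a + c)\<^sup>2 * (b + c))) =
      ?W 2 1 0 + (?W 2 0 1 + (of_int 2 * ?W 1 1 1 + (of_int 2 * ?W 1 0 2 + (?W 0 1 2 + ?W 0 0 3))))"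
    by (simp only: wgf_add wgf_cmult)
  also have "\<dots> = of_int 2 * (?A 1 * ?A 1 * ?A 1)"
    unfolding wgf_tri3_mult[symmetric] A0 by simp
  also have "\<dots> = 2 * euler_fps ^ 9"
  proof -
    have "euler_fps ^ 9 = euler_fps ^ 3 * euler_fps ^ 3 * euler_fps ^ 3"
      by (simp flip: power_add)
    thus ?thesis by (simp add: jacobi_cube)
  qed
  finally show ?thesis ..
qed

text \<open>These are the pairs for which the numerator in \<open>norm_exp\<close> is divisible by
  3; in the remaining residue class the sum over c cancels.\<close>

definition norm_index_set :: "(int \<times> int) set" where
  "norm_index_set = {(m, n). (m + n) mod 3 \<noteq> 1}"

definition norm_exp :: "int \<times> int \<Rightarrow> nat" where
  "norm_exp = (\<lambda>(m, n). nat ((m\<^sup>2 + n\<^sup>2 - m * n + m + n) div 3))"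

lemma norm_form_nonneg: "0 \<le> (u::int)\<^sup>2 - u * v + v\<^sup>2"
proof -
  have "4 * (u\<^sup>2 - u * v + v\<^sup>2) = (2 * u - v)\<^sup>2 + 3 * v\<^sup>2"
    by (simp add: power2_eq_square algebra_simps)
  also have "\<dots> \<ge> 0" by simp
  finally show ?thesis by simp
qed

text \<open>Shifting both variables by 1 turns the exponent into the norm form of the Eisenstein
  integers. Divisibility by 3 is read off from (m + n) (m + n + 1) - 3 m n.\<close>

lemma norm_exp_eq:
  assumes "(m, n) \<in> norm_index_set"
  shows "3 * int (norm_exp (m, n)) + 1 = (m + 1)\<^sup>2 - (m + 1) * (n + 1) + (n + 1)\<^sup>2"
proof -
  let ?q = "m\<^sup>2 + n\<^sup>2 - m * n + m + n"
  have q: "?q + 1 = (m + 1)\<^sup>2 - (m + 1) * (n + 1) + (n + 1)\<^sup>2"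
    by (simp add: power2_eq_square algebra_simps)
  have "3 dvd (m + n) \<or> 3 dvd (m + n + 1)"
    using assms by (simp add: norm_index_set_def) presburger
  hence "3 dvd (m + n) * (m + n + 1) - 3 * (m * n)" by auto
  also have "(m + n) * (m + n + 1) - 3 * (m * n) = ?q"
    by (simp add: power2_eq_square algebra_simps)
  finally obtain r where r: "?q = 3 * r" ..
  \<comment> \<open>This only gives \<open>?q >= -1\<close>; being a multiple of 3,
    \<open>?q\<close> is then nonnegative, so \<open>nat\<close> does not truncate.\<close>
  have "0 \<le> ?q + 1" unfolding q by (rule norm_form_nonneg)
  hence "0 \<le> r" using r by linarith
  thus ?thesis using q r by (simp add: norm_exp_def)
qed

text \<open>The norm form is positive definite: four times its value is (2 u - v)^2 + 3 v^2, and
  symmetrically in u and v.\<close>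

lemma finite_fibres_norm_exp: "finite_fibres norm_index_set norm_exp"
  unfolding finite_fibres_def
proof
  fix N
  have "{x \<in> norm_index_set. norm_exp x = N} \<subseteq>
      {- (4 * (3 * int N + 1)) - 1..4 * (3 * int N + 1)} \<times> {- (4 * (3 * int N + 1)) - 1..4 * (3 * int N + 1)}"
  proof (clarify)
    fix m n assume mn: "(m, n) \<in> norm_index_set" "N = norm_exp (m, n)"
    define u v where "u = m + 1" and "v = n + 1"
    let ?M = "3 * int (norm_exp (m, n)) + 1"
    have M: "?M = u\<^sup>2 - u * v + v\<^sup>2" using norm_exp_eq[OF mn(1)] by (simp add: u_def v_def)
    have "4 * ?M = (2 * u - v)\<^sup>2 + 3 * v\<^sup>2" "4 * ?M = (2 * v - u)\<^sup>2 + 3 * u\<^sup>2"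
      unfolding M by (simp_all add: power2_eq_square algebra_simps)
    moreover have "0 \<le> (2 * u - v)\<^sup>2" "0 \<le> (2 * v - u)\<^sup>2" "0 \<le> u\<^sup>2" "0 \<le> v\<^sup>2" by simp_all
    ultimately have "u\<^sup>2 \<le> 4 * ?M" "v\<^sup>2 \<le> 4 * ?M" by linarith+
    moreover have "\<bar>x\<bar> \<le> x\<^sup>2" for x :: int
      using self_le_power[of "\<bar>x\<bar>" 2] by (cases "x = 0") auto
    ultimately have "\<bar>u\<bar> \<le> 4 * ?M" "\<bar>v\<bar> \<le> 4 * ?M" by (meson order_trans)+
    thus "m \<in> {- (4 * ?M) - 1..4 * ?M} \<and> n \<in> {- (4 * ?M) - 1..4 * ?M}"
      by (auto simp: u_def v_def)
  qed
  thus "finite {x \<in> norm_index_set. norm_exp x = N}"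
    by (rule finite_subset) simp
qed

text \<open>
  With \<open>s = m + n = a + b + 2 c\<close>, twice the exponent of \<open>(m - c, n - c, c)\<close> depends on \<open>c\<close> through
  \<open>3 c\<^sup>2 - (2 s + 1) c\<close>. Its centre lies near \<open>s / 3\<close>, and \<open>k\<close> is the pentagonal index
  relative to it. For \<open>s \<equiv> 1 (mod 3)\<close> the reflection in the centre preserves integers and
  flips the sign, so these terms cancel.
\<close>

definition regroup :: "int \<times> (int \<times> int) \<Rightarrow> (int \<times> int) \<times> int" where
  "regroup = (\<lambda>(k, m, n). let s = m + n; c = (if s mod 3 = 0 then s div 3 - k else s div 3 + 1 + k)
     in ((m - c, n - c), c))"

definition regrouped :: "((int \<times> int) \<times> int) set" where
  "regrouped = {((a, b), c). (a + b + 2 * c) mod 3 \<noteq> 1}"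

lemma bij_betw_regroup: "bij_betw regroup (UNIV \<times> norm_index_set) regrouped"
proof (rule bij_betw_byWitness)
  let ?g = "\<lambda>((a, b), c). let m = a + c; n = b + c; s = m + n
    in ((if s mod 3 = 0 then s div 3 - c else c - s div 3 - 1), m, n) :: int \<times> (int \<times> int)"
  show "\<forall>x\<in>UNIV \<times> norm_index_set. ?g (regroup x) = x"
    by (auto simp: regroup_def Let_def)
  show "\<forall>y\<in>regrouped. regroup (?g y) = y"
    by (auto simp: regroup_def Let_def)
  show "regroup ` (UNIV \<times> norm_index_set) \<subseteq> regrouped"
    by (auto simp: regroup_def Let_def regrouped_def norm_index_set_def algebra_simps)
  show "?g ` regrouped \<subseteq> UNIV \<times> norm_index_set"
    by (auto simp: Let_def regrouped_def norm_index_set_def algebra_simps)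
qed

lemma two_tri3:
  "2 * int (tri3 ((m - c, n - c), c)) = m\<^sup>2 + n\<^sup>2 + m + n + c * (3 * c - (2 * (m + n) + 1))"
  unfolding tri3_def by (simp add: distrib_left two_tri) (simp add: power2_eq_square algebra_simps)

text \<open>Substituting c = t - k for s = 3 t, or c = t + 1 + k for s = 3 t + 2, turns the
  c-dependent part into k (3 k + 1) plus a constant. The factor 6 clears the denominators 2 and
  3.\<close>

lemma tri3_regroup:
  assumes "(m, n) \<in> norm_index_set"
  shows "tri3 (regroup (k, m, n)) = pent k + norm_exp (m, n)"
proof -
  define t where "t = (m + n) div 3"
  have E: "6 * int (norm_exp (m, n)) = 2 * (m\<^sup>2 + n\<^sup>2 - m * n + m + n)"
    using norm_exp_eq[OF assms] by (simp add: power2_eq_square algebra_simps)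
  have "m + n = 3 * t + (m + n) mod 3" by (simp add: t_def)
  moreover have "(m + n) mod 3 = 0 \<or> (m + n) mod 3 = 2"
    using assms by (simp add: norm_index_set_def) presburger
  ultimately consider "m + n = 3 * t" "(m + n) mod 3 = 0" | "m + n = 3 * t + 2" "(m + n) mod 3 = 2"
    by force
  hence "6 * int (tri3 (regroup (k, m, n))) = 6 * int (pent k + norm_exp (m, n))"
  proof cases
    case 1
    have n: "n = 3 * t - m" using 1 by simp
    have "regroup (k, m, n) = ((m - (t - k), n - (t - k)), t - k)"
      using 1 by (simp add: regroup_def Let_def t_def)
    hence "6 * int (tri3 (regroup (k, m, n))) =
        3 * (m\<^sup>2 + n\<^sup>2 + m + n + (t - k) * (3 * (t - k) - (2 * (m + n) + 1)))"
      using two_tri3[of m "t - k" n] by simp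
    also have "\<dots> = 3 * (k * (3 * k + 1)) + 2 * (m\<^sup>2 + n\<^sup>2 - m * n + m + n)"
      unfolding n by (simp add: power2_eq_square algebra_simps)
    finally show ?thesis using two_pent[of k] E by simp
  next
    case 2
    have n: "n = 3 * t + 2 - m" using 2 by simp
    have "regroup (k, m, n) = ((m - (t + 1 + k), n - (t + 1 + k)), t + 1 + k)"
      using 2 by (simp add: regroup_def Let_def t_def)
    hence "6 * int (tri3 (regroup (k, m, n))) =
        3 * (m\<^sup>2 + n\<^sup>2 + m + n + (t + 1 + k) * (3 * (t + 1 + k) - (2 * (m + n) + 1)))"
      using two_tri3[of m "t + 1 + k" n] by simp
    also have "\<dots> = 3 * (k * (3 * k + 1)) + 2 * (m\<^sup>2 + n\<^sup>2 - m * n + m + n)"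
      unfolding n by (simp add: power2_eq_square algebra_simps)
    finally show ?thesis using two_pent[of k] E by simp
  qed
  thus ?thesis by (simp del: of_nat_add)
qed

definition norm_weight :: "int \<times> int \<Rightarrow> int" where
  "norm_weight = (\<lambda>(m, n). (if (m + n) mod 3 = 0 then 1 else - 1) * (m\<^sup>2 * n))"

text \<open>The sign exponent m + n - c equals 2 t + k or 2 t + 1 - k in the two residue classes,
  which explains the sign in \<open>norm_weight\<close>.\<close>

lemma weight_regroup:
  assumes "(m, n) \<in> norm_index_set" "regroup (k, m, n) = ((a, b), c)"
  shows "alt_sign (a + b + c) * ((a + c)\<^sup>2 * (b + c)) = alt_sign k * norm_weight (m, n)"
proof -
  have ab: "a = m - c" "b = n - c" using assms(2) by (auto simp: regroup_def Let_def)
  have "alt_sign (m + n - c) = alt_sign k * (if (m + n) mod 3 = 0 then 1 else - 1)"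
  proof (cases "(m + n) mod 3 = 0")
    case True
    then obtain t where "m + n = 3 * t" by auto
    thus ?thesis using assms(2) by (auto simp: regroup_def Let_def alt_sign_def)
  next
    case False
    then have "(m + n) mod 3 = 2" 
      using assms(1) by (simp add: norm_index_set_def)
    then obtain t where "m + n = 3 * t + 2" by (metis mult_div_mod_eq)
    thus ?thesis using assms(2) False by (auto simp: regroup_def Let_def alt_sign_def)
  qed
  moreover have "a + b + c = m + n - c" "a + c = m" "b + c = n" using ab by simp_all
  ultimately show ?thesis by (simp only: norm_weight_def prod.case mult.assoc)
qed

lemma wgf_regrouped:
  "wgf UNIV tri3 (\<lambda>((a, b), c). alt_sign (a + b + c) * ((a + c)\<^sup>2 * (b + c))) =
   wgf regrouped tri3 (\<lambda>((a, b), c). alt_sign (a + b + c) * ((a + c)\<^sup>2 * (b + c)))"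
    (is "wgf _ _ ?w = _")
proof (rule wgf_involution[OF finite_fibres_tri3])
  \<comment> \<open>For s = 3 t + 1 the centre (2 s + 1) / 6 is t + 1/2, so the reflection is c -> 2
    t + 1 - c with m and n fixed.\<close>
  let ?h = "\<lambda>((a, b), c). let m = a + c; n = b + c; c' = 2 * ((m + n) div 3) + 1 - c
    in ((m - c', n - c'), c')"
  fix x :: "(int \<times> int) \<times> int" assume x: "x \<in> UNIV - regrouped"
  obtain a b c where abc: "x = ((a, b), c)" by (metis surj_pair)
  define m n where "m = a + c" and "n = b + c"
  have x': "x = ((m - c, n - c), c)" by (simp add: abc m_def n_def)
  have "(m + n) mod 3 = 1"
    using x by (simp add: abc regrouped_def m_def n_def algebra_simps)
  then obtain t where t: "m + n = 3 * t + 1" by (metis mult_div_mod_eq)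
  hence d: "(m + n) div 3 = t" by simp
  define c' where "c' = 2 * t + 1 - c"
  have h: "?h x = ((m - c', n - c'), c')"
    by (simp add: x' d c'_def)
  have n: "n = 3 * t + 1 - m" using t by simp
  have "2 * int (tri3 ((m - c', n - c'), c')) = 2 * int (tri3 ((m - c, n - c), c))"
    unfolding two_tri3 c'_def n by (simp add: power2_eq_square algebra_simps)
  hence "tri3 ((m - c', n - c'), c') = tri3 ((m - c, n - c), c)" by (rule double_int_eqD)
  hence "tri3 (?h x) = tri3 x" by (simp only: h) (simp only: x')
  moreover have "?h x \<in> UNIV - regrouped"
    using t unfolding h regrouped_def by simp
  moreover have "?h (?h x) = x"
    unfolding h by (simp add: d) (simp add: c'_def x')
  moreover have "?w (?h x) = - ?w x"
  proof -
    have "?w ((m - d, n - d), d) = alt_sign (m + n - d) * (m\<^sup>2 * n)" for d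
      by (simp add: algebra_simps)
    moreover have "alt_sign (m + n - c') = - alt_sign (m + n - c)"
      by (simp add: c'_def alt_sign_def)
    ultimately have "?w ((m - c', n - c'), c') = - ?w ((m - c, n - c), c)"
      by (simp only: mult_minus_left)
    thus ?thesis by (simp only: h) (simp only: x')
  qed
  ultimately show "?h x \<in> UNIV - regrouped \<and> ?h (?h x) = x \<and> tri3 (?h x) = tri3 x \<and> ?w (?h x) = - ?w x"
    by blast
qed simp

text \<open>After regrouping, the sum over k splits off as Euler's pentagonal series, and the
  resulting factor \<open>euler_fps\<close> cancels.\<close>

lemma euler_eighth_power: "2 * euler_fps ^ 8 = wgf norm_index_set norm_exp norm_weight"
proof -
  have "2 * euler_fps ^ 9 = wgf regrouped tri3 (\<lambda>((a, b), c). alt_sign (a + b + c) * ((a + c)\<^sup>2 * (b + c)))"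
    unfolding euler_ninth_power wgf_regrouped ..
  also have "\<dots> = wgf (UNIV \<times> norm_index_set) (\<lambda>(k, x). pent k + norm_exp x)
      (\<lambda>(k, x). alt_sign k * norm_weight x)"
  proof (rule wgf_reindex[OF bij_betw_regroup, symmetric])
    fix x :: "int \<times> (int \<times> int)"
    assume "x \<in> UNIV \<times> norm_index_set"
    then obtain k m n where x: "x = (k, m, n)" "(m, n) \<in> norm_index_set" by auto
    show "tri3 (regroup x) = (\<lambda>(k, x). pent k + norm_exp x) x"
      using tri3_regroup x by simp
    show "(\<lambda>((a, b), c). alt_sign (a + b + c) * ((a + c)\<^sup>2 * (b + c))) (regroup x) =
        (\<lambda>(k, x). alt_sign k * norm_weight x) x"
      using weight_regroup[OF x(2)] x(1) by (auto split: prod.split)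
  qed
  also have "\<dots> = euler_fps * wgf norm_index_set norm_exp norm_weight"
    unfolding euler_pentagonal by (rule wgf_mult[symmetric, OF finite_fibres_pent finite_fibres_norm_exp])
  finally have "euler_fps * (2 * euler_fps ^ 8) = euler_fps * wgf norm_index_set norm_exp norm_weight"
    by (simp add: mult_ac eval_nat_numeral)
  thus ?thesis by simp
qed

lemma euler_eighth_power_nth:
  assumes "\<And>u v. 3 * int N + 1 \<noteq> u\<^sup>2 - u * v + v\<^sup>2"
  shows "(euler_fps ^ 8) $ N = 0"
proof -
  have "{x \<in> norm_index_set. norm_exp x = N} = {}"
    using assms norm_exp_eq by (metis (mono_tags, lifting) empty_Collect_eq surj_pair)
  hence "(2 * euler_fps ^ 8) $ N = 0"
    unfolding euler_eighth_power wgf_nth by (metis sum.empty)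
  hence "2 * (euler_fps ^ 8) $ N = 0" by (simp only: mult_2 fps_add_nth)
  thus ?thesis by linarith
qed

subsection \<open>Regular partitions modulo 5\<close>

text \<open>Congruences between series are handled as divisibility by a constant in
  \<open>int fps\<close>; this passes to coefficients and back.\<close>

lemma of_int_dvd_fps_iff: "(of_int c :: int fps) dvd f \<longleftrightarrow> (\<forall>n. c dvd f $ n)"
proof
  assume "\<forall>n. c dvd f $ n"
  hence "f = of_int c * Abs_fps (\<lambda>n. f $ n div c)"
    by (simp add: fps_eq_iff fps_of_int[symmetric])
  thus "of_int c dvd f" by (rule dvdI)
qed (auto elim!: dvdE simp: fps_of_int[symmetric])

text \<open>As \<open>u $ 0 = 1\<close>, the n-th coefficient of the product is \<open>f $ n\<close>
  plus a combination of earlier coefficients of \<open>f\<close>.\<close>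

lemma of_int_dvd_fps_cancel:
  fixes f u :: "int fps"
  assumes "of_int c dvd f * u" "u $ 0 = 1"
  shows "of_int c dvd f"
  unfolding of_int_dvd_fps_iff
proof
  fix n
  show "c dvd f $ n"
  proof (induction n rule: less_induct)
    case (less n)
    have "(f * u) $ n = (\<Sum>i<n. f $ i * u $ (n - i)) + f $ n"
      using assms(2) by (simp add: fps_mult_nth atLeast0AtMost lessThan_Suc_atMost[symmetric])
    moreover have "c dvd (f * u) $ n"
      using assms(1) by (simp add: of_int_dvd_fps_iff)
    moreover have "c dvd (\<Sum>i<n. f $ i * u $ (n - i))"
      using less by (intro dvd_sum dvd_mult2) auto
    ultimately show ?case by (metis dvd_add_right_iff)
  qed
qed

lemma dvd_diff_mult:
  fixes a b c d :: "'a :: comm_ring_1"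
  assumes "m dvd a - b" "m dvd c - d"
  shows "m dvd a * c - b * d"
proof -
  have "a * c - b * d = a * (c - d) + (a - b) * d" by (simp add: algebra_simps)
  thus ?thesis using assms by simp
qed

lemma euler_poly_fifth_power: "5 dvd euler_poly n ^ 5 - (\<Prod>i=1..n. 1 - fps_X ^ (5 * i))"
proof (induction n)
  case (Suc n)
  have "(1 - x) ^ 5 - (1 - x ^ 5) = 5 * (- x + 2 * x ^ 2 - 2 * x ^ 3 + x ^ 4)" for x :: "int fps"
    by (simp add: eval_nat_numeral algebra_simps)
  moreover have "(fps_X :: int fps) ^ (5 * Suc n) = (fps_X ^ Suc n) ^ 5"
    by (simp only: power_mult[symmetric] mult.commute)
  ultimately have "5 dvd (1 - fps_X ^ Suc n) ^ 5 - (1 - (fps_X :: int fps) ^ (5 * Suc n))"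
    by (simp only: dvd_triv_left)
  from dvd_diff_mult[OF Suc this] show ?case
    by (simp add: euler_poly_Suc power_mult_distrib del: power_Suc)
qed simp

section \<open>Generating function of regular partitions\<close>

definition regular_partitions :: "nat \<Rightarrow> nat \<Rightarrow> nat multiset set" where
  "regular_partitions l n = {L. regular_partition l L \<and> sum_mset L = n}"

text \<open>Bounding the parts by \<open>m\<close> makes the generating function a finite product,
  accessible by induction on \<open>m\<close>.\<close>

definition bounded_regular_partitions :: "nat \<Rightarrow> nat \<Rightarrow> nat \<Rightarrow> nat multiset set" where
  "bounded_regular_partitions l m n = {L \<in> regular_partitions l n. \<forall>x\<in>#L. x \<le> m}"

lemma finite_regular_partitions: "finite (regular_partitions l n)"
  by (rule finite_subset[OF _ finite_partitions_le[of n]])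
     (auto simp: regular_partitions_def regular_partition_def)

lemma finite_bounded_regular_partitions: "finite (bounded_regular_partitions l m n)"
  unfolding bounded_regular_partitions_def using finite_regular_partitions by simp

lemma bounded_regular_partitions_eq:
  assumes "n \<le> m"
  shows "bounded_regular_partitions l m n = regular_partitions l n"
proof -
  have "x \<le> n" if "x \<in># L" "sum_mset L = n" for x L
    using that sum_mset.remove[of x L] by simp
  thus ?thesis
    using assms by (fastforce simp: bounded_regular_partitions_def regular_partitions_def)
qed

lemma bounded_regular_partitions_dvd:
  "l dvd Suc m \<Longrightarrow> bounded_regular_partitions l (Suc m) n = bounded_regular_partitions l m n"
  by (force simp: bounded_regular_partitions_def regular_partitions_def regular_partition_def le_Suc_eq)

text \<open>Either \<open>Suc m\<close> is not a part, or one copy of it is removed; further copies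
  may remain, so the bound stays \<open>Suc m\<close>.\<close>

lemma card_bounded_regular_partitions_Suc:
  assumes "\<not> l dvd Suc m"
  shows "card (bounded_regular_partitions l (Suc m) n) = card (bounded_regular_partitions l m n) +
    (if Suc m \<le> n then card (bounded_regular_partitions l (Suc m) (n - Suc m)) else 0)"
proof -
  let ?A = "bounded_regular_partitions l m n"
  let ?B = "if Suc m \<le> n then add_mset (Suc m) ` bounded_regular_partitions l (Suc m) (n - Suc m) else {}"
  have "bounded_regular_partitions l (Suc m) n = ?A \<union> ?B"
  proof (intro equalityI subsetI)
    fix L assume L: "L \<in> bounded_regular_partitions l (Suc m) n"
    show "L \<in> ?A \<union> ?B"
    proof (cases "Suc m \<in># L")
      case True
      then obtain M where M: "L = add_mset (Suc m) M" by (metis insert_DiffM)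
      have "M \<in> bounded_regular_partitions l (Suc m) (n - Suc m)" "Suc m \<le> n"
        using L unfolding M
        by (auto simp: bounded_regular_partitions_def regular_partitions_def regular_partition_def
            is_partition_def)
      thus ?thesis using M by simp
    next
      case False
      hence "\<forall>x\<in>#L. x \<le> m"
        using L by (metis (mono_tags, lifting) bounded_regular_partitions_def le_Suc_eq mem_Collect_eq)
      thus ?thesis using L by (simp add: bounded_regular_partitions_def)
    qed
  next
    fix L assume "L \<in> ?A \<union> ?B"
    thus "L \<in> bounded_regular_partitions l (Suc m) n"
      using assms
      by (auto simp: bounded_regular_partitions_def regular_partitions_def regular_partition_def
          is_partition_def split: if_splits)
  qed
  moreover have "?A \<inter> ?B = {}"
    by (auto simp: bounded_regular_partitions_def)
  ultimately show ?thesis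
    by (simp add: card_Un_disjoint finite_bounded_regular_partitions card_image inj_on_def)
qed

definition regular_fps :: "nat \<Rightarrow> int fps" where
  "regular_fps l = Abs_fps (\<lambda>n. int (card (regular_partitions l n)))"

definition bounded_regular_fps :: "nat \<Rightarrow> nat \<Rightarrow> int fps" where
  "bounded_regular_fps l m = Abs_fps (\<lambda>n. int (card (bounded_regular_partitions l m n)))"

lemma bounded_regular_fps_prod:
  "bounded_regular_fps l m * (\<Prod>i | i \<in> {1..m} \<and> \<not> l dvd i. 1 - fps_X ^ i) = 1"
proof (induction m)
  case 0
  have "bounded_regular_partitions l 0 n = (if n = 0 then {{#}} else {})" for n
    by (auto simp: bounded_regular_partitions_def regular_partitions_def regular_partition_def
        is_partition_def intro: multiset_nonemptyE)
       (metis multiset_nonemptyE not_gr_zero sum_mset.empty)+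
  thus ?case by (simp add: bounded_regular_fps_def fps_eq_iff)
next
  case (Suc m)
  show ?case
  proof (cases "l dvd Suc m")
    case True
    have "{i. i \<in> {1..Suc m} \<and> \<not> l dvd i} = {i. i \<in> {1..m} \<and> \<not> l dvd i}"
      using True by (auto simp: le_Suc_eq)
    thus ?thesis
      using Suc True by (simp add: bounded_regular_fps_def bounded_regular_partitions_dvd)
  next
    case False
    have "{i. i \<in> {1..Suc m} \<and> \<not> l dvd i} = insert (Suc m) {i. i \<in> {1..m} \<and> \<not> l dvd i}"
      using False by (auto simp: le_Suc_eq)
    moreover have "bounded_regular_fps l (Suc m) * (1 - fps_X ^ Suc m) = bounded_regular_fps l m"
      using card_bounded_regular_partitions_Suc[OF False]
      by (auto simp: fps_eq_iff right_diff_distrib bounded_regular_fps_def fps_X_power_mult_right_nth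
          simp del: power_Suc)
    ultimately show ?thesis
      using Suc by (simp add: mult.assoc[symmetric] del: power_Suc)
  qed
qed

text \<open>Among the factors up to \<open>l * m\<close>, those with index not divisible by
  \<open>l\<close> cancel against the generating function, leaving the multiples of
  \<open>l\<close>.\<close>

lemma bounded_regular_fps_euler_poly:
  assumes "l > 0"
  shows "bounded_regular_fps l (l * m) * euler_poly (l * m) = (\<Prod>i=1..m. 1 - fps_X ^ (l * i))"
proof -
  have split: "{1..l * m} = {i. i \<in> {1..l * m} \<and> \<not> l dvd i} \<union> (*) l ` {1..m}"
    using assms by (auto elim!: dvdE)
  have "euler_poly (l * m) = (\<Prod>i | i \<in> {1..l * m} \<and> \<not> l dvd i. 1 - fps_X ^ i) *
      (\<Prod>i\<in>(*) l ` {1..m}. 1 - fps_X ^ i)"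
    unfolding euler_poly_def by (subst split, rule prod.union_disjoint) auto
  also have "(\<Prod>i\<in>(*) l ` {1..m}. 1 - fps_X ^ i :: int fps) = (\<Prod>i=1..m. 1 - fps_X ^ (l * i))"
    using assms by (subst prod.reindex) (auto simp: inj_on_def)
  finally show ?thesis
    by (simp only: mult.assoc[symmetric] bounded_regular_fps_prod mult_1_left)
qed

text \<open>Modulo 5 the series is f(q^5) / f(q) = f^5 / f = f^4. The product with f is compared
  coefficientwise through truncations, then f is cancelled.\<close>

lemma regular_fps_cong: "5 dvd regular_fps 5 - euler_fps ^ 4"
proof -
  have "5 dvd (regular_fps 5 * euler_fps - euler_fps ^ 5) $ N" for N
  proof -
    let ?R = "\<Prod>i=1..N. 1 - fps_X ^ (5 * i) :: int fps"
    have "eq_upto N (regular_fps 5) (bounded_regular_fps 5 (5 * N))"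
      by (simp add: eq_upto_def regular_fps_def bounded_regular_fps_def bounded_regular_partitions_eq)
    hence "eq_upto N (regular_fps 5 * euler_fps) (bounded_regular_fps 5 (5 * N) * euler_poly (5 * N))"
      by (intro eq_upto_mult eq_upto_euler_fps) auto
    hence 1: "(regular_fps 5 * euler_fps) $ N = ?R $ N"
      using bounded_regular_fps_euler_poly[of 5 N] by (simp add: eq_upto_def)
    have 2: "(euler_fps ^ 5) $ N = (euler_poly N ^ 5) $ N"
      using eq_upto_power[OF eq_upto_euler_fps[of N N], of 5] by (simp add: eq_upto_def)
    have "of_int 5 dvd euler_poly N ^ 5 - ?R"
      using euler_poly_fifth_power by simp
    hence "5 dvd (euler_poly N ^ 5 - ?R) $ N"
      unfolding of_int_dvd_fps_iff by blast
    thus ?thesis by (simp add: 1 2 dvd_diff_commute)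
  qed
  hence "of_int 5 dvd regular_fps 5 * euler_fps - euler_fps ^ 5"
    unfolding of_int_dvd_fps_iff by blast
  also have "regular_fps 5 * euler_fps - euler_fps ^ 5 = (regular_fps 5 - euler_fps ^ 4) * euler_fps"
    by (simp add: left_diff_distrib flip: power_Suc2)
  finally have "of_int 5 dvd regular_fps 5 - euler_fps ^ 4"
    by (rule of_int_dvd_fps_cancel) simp
  thus ?thesis by simp
qed

lemma B5_eq_nth: "int (B5 (int n)) = (regular_fps 5 ^ 2) $ n"
proof -
  let ?R = "regular_partitions 5"
  have "B5_pairs (int n) = (\<Union>k\<in>{0..n}. ?R k \<times> ?R (n - k))"
    by (auto simp: B5_pairs_def regular_partitions_def simp del: of_nat_add)
  moreover have "card (\<Union>k\<in>{0..n}. ?R k \<times> ?R (n - k)) = (\<Sum>k=0..n. card (?R k \<times> ?R (n - k)))"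
    by (intro card_UN_disjoint)
       (use finite_regular_partitions in \<open>auto simp: regular_partitions_def\<close>)
  ultimately show ?thesis
    by (simp add: B5_def power2_eq_square fps_mult_nth regular_fps_def card_cartesian_product)
qed

lemma B5_cong: "[int (B5 (int n)) = (euler_fps ^ 8) $ n] (mod 5)"
proof -
  have "regular_fps 5 ^ 2 - euler_fps ^ 8 =
      (regular_fps 5 - euler_fps ^ 4) * (regular_fps 5 + euler_fps ^ 4)"
    by (simp add: algebra_simps power2_eq_square flip: power_add)
  hence "of_int 5 dvd regular_fps 5 ^ 2 - euler_fps ^ 8"
    using regular_fps_cong by simp
  hence "5 dvd (regular_fps 5 ^ 2 - euler_fps ^ 8) $ n"
    unfolding of_int_dvd_fps_iff by blast
  thus ?thesis by (simp add: B5_eq_nth cong_iff_dvd_diff)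
qed

subsection \<open>Primes dividing the norm form\<close>

lemma fermat_theorem_int:
  fixes a :: int
  assumes "prime p" "\<not> int p dvd a"
  shows "[a ^ (p - 1) = 1] (mod int p)"
proof -
  define b where "b = nat (a mod int p)"
  have "p > 0" using assms(1) prime_gt_0_nat by blast
  hence b: "int b = a mod int p" by (simp add: b_def)
  hence "\<not> p dvd b" using assms(2) by (metis dvd_mod_iff int_dvd_int_iff dvd_refl)
  hence "[b ^ (p - 1) = 1] (mod p)" using assms(1) by (intro fermat_theorem)
  hence "[int b ^ (p - 1) = 1] (mod int p)"
    by (metis cong_int_iff of_nat_1 of_nat_power)
  thus ?thesis unfolding b by (simp add: cong_def power_mod)
qed

lemma not_dvd_three:
  assumes "[p = 2] (mod 3)"
  shows "\<not> int p dvd 3"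
proof
  assume "int p dvd 3"
  hence dvd: "p dvd 3" by (metis int_dvd_int_iff of_nat_numeral)
  hence "p \<le> 3" by (rule dvd_imp_le) simp
  moreover have "p mod 3 = 2" using assms by (simp add: cong_def)
  ultimately have "p = 2" by presburger
  thus False using dvd by simp
qed

text \<open>This is the inertness of p in the Eisenstein integers. If p divides neither variable,
  u^3 = -v^3 and Fermat's theorem force v = s u modulo p with s = 1 or -1, and the form becomes (2 -
  s) u^2 with 2 - s equal to 1 or 3.\<close>

lemma prime_dvd_norm_form:
  fixes u v :: int
  assumes p: "prime p" "[p = 2] (mod 3)" and dvd: "int p dvd u\<^sup>2 - u * v + v\<^sup>2"
  shows "int p dvd u \<and> int p dvd v"
proof (rule ccontr)
  assume neg: "\<not> ?thesis"
  have ip: "prime (int p)" using p by simp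
  have dvd': "int p dvd u \<longleftrightarrow> int p dvd v"
  proof
    assume "int p dvd u"
    hence "int p dvd u\<^sup>2 - u * v" by (auto simp: power2_eq_square)
    hence "int p dvd v\<^sup>2" using dvd by (metis dvd_add_right_iff)
    thus "int p dvd v" using ip prime_dvd_power by blast
  next
    assume "int p dvd v"
    hence "int p dvd v\<^sup>2 - u * v" by (auto simp: power2_eq_square)
    hence "int p dvd u\<^sup>2" using dvd by (metis dvd_add_left_iff add_diff_eq diff_add_eq)
    thus "int p dvd u" using ip prime_dvd_power by blast
  qed
  with neg have ndvd: "\<not> int p dvd u" "\<not> int p dvd v" by auto
  define r where "r = p div 3"
  have "p mod 3 = 2" using p(2) by (simp add: cong_def)
  \<comment> \<open>Since p - 1 = 3 r + 1, the r-th power of the cubic congruence is one factor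
    short of Fermat's exponent.\<close>
  hence r: "p - 1 = 3 * r + 1" unfolding r_def by presburger
  define s :: int where "s = (-1) ^ r"
  have "u ^ 3 - (- (v ^ 3)) = (u + v) * (u\<^sup>2 - u * v + v\<^sup>2)"
    by (simp add: power2_eq_square power3_eq_cube algebra_simps)
  hence "[u ^ 3 = - (v ^ 3)] (mod int p)"
    using dvd by (simp add: cong_iff_dvd_diff)
  hence "[(u ^ 3) ^ r = (- (v ^ 3)) ^ r] (mod int p)" by (rule cong_pow)
  hence "[u ^ (3 * r) = s * v ^ (3 * r)] (mod int p)"
    by (simp add: s_def power_mult power_minus[of "v ^ 3"])
  hence "[u * u ^ (3 * r) = u * (s * v ^ (3 * r))] (mod int p)"
    by (intro cong_mult) auto
  moreover have "[u * u ^ (3 * r) = 1] (mod int p)" "[v * v ^ (3 * r) = 1] (mod int p)"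
    using fermat_theorem_int[OF p(1)] ndvd unfolding r by simp_all
  ultimately have "[v * v ^ (3 * r) = (s * u) * v ^ (3 * r)] (mod int p)"
    by (metis cong_sym cong_trans mult.assoc mult.commute)
  moreover have "coprime (v ^ (3 * r)) (int p)"
    using ip ndvd by (metis coprime_commute coprime_power_right_iff prime_imp_coprime)
  ultimately have "[v = s * u] (mod int p)"
    using cong_mult_rcancel by blast
  hence "[u\<^sup>2 - u * v + v\<^sup>2 = u\<^sup>2 - u * (s * u) + (s * u)\<^sup>2] (mod int p)"
    by (intro cong_add cong_diff cong_mult cong_pow) auto
  hence "int p dvd u\<^sup>2 - u * (s * u) + (s * u)\<^sup>2"
    using dvd cong_dvd_iff by blast
  also have "\<dots> = (2 - s) * u\<^sup>2"
    by (simp add: s_def power_mult_distrib power2_eq_square algebra_simps flip: power_add mult_2)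
  finally have "int p dvd 2 - s"
    using ip ndvd by (metis prime_dvd_mult_iff prime_dvd_power)
  moreover have "2 - s = 1 \<or> 2 - s = 3" by (simp add: s_def minus_one_power_iff)
  moreover have "\<not> int p dvd 1" using ip not_prime_unit by blast
  ultimately show False using not_dvd_three[OF p(2)] by auto
qed

text \<open>Descent: once p divides the form it divides both variables, and dividing them by p
  removes exactly p^2 from the form.\<close>

lemma norm_form_odd_power_dvd:
  fixes u v :: int
  assumes p: "prime p" "[p = 2] (mod 3)"
    and "int p ^ (2 * k + 1) dvd u\<^sup>2 - u * v + v\<^sup>2"
  shows "int p ^ (2 * k + 2) dvd u\<^sup>2 - u * v + v\<^sup>2"
  using assms(3)
proof (induction k arbitrary: u v)
  case (0 u v)
  hence "int p dvd u\<^sup>2 - u * v + v\<^sup>2" by simp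
  hence uv: "int p dvd u" "int p dvd v" using prime_dvd_norm_form[OF p] by blast+
  have "int p * int p dvd u * u - u * v + v * v"
    by (intro dvd_add dvd_diff mult_dvd_mono uv)
  thus ?case by (simp add: power2_eq_square)
next
  case (Suc k u v)
  have "int p dvd u\<^sup>2 - u * v + v\<^sup>2"
    using Suc.prems by (rule dvd_trans[rotated]) simp
  hence "int p dvd u" "int p dvd v" using prime_dvd_norm_form[OF p] by blast+
  then obtain a b where ab: "u = int p * a" "v = int p * b" by (elim dvdE)
  have eq: "u\<^sup>2 - u * v + v\<^sup>2 = int p ^ 2 * (a\<^sup>2 - a * b + b\<^sup>2)"
    unfolding ab by (simp add: power2_eq_square algebra_simps)
  have p0: "int p ^ 2 \<noteq> 0"
    using p(1) by (metis not_prime_0 of_nat_eq_0_iff power_not_zero)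
  have pow: "int p ^ (2 * Suc k + i) = int p ^ 2 * int p ^ (2 * k + i)" for i
    by (simp add: power2_eq_square)
  have "int p ^ (2 * k + 1) dvd a\<^sup>2 - a * b + b\<^sup>2"
    using Suc.prems p0 unfolding eq pow by simp
  hence "int p ^ (2 * k + 2) dvd a\<^sup>2 - a * b + b\<^sup>2" by (rule Suc.IH)
  thus ?case unfolding eq pow by (rule mult_dvd_mono[OF dvd_refl])
qed

theorem corollary1p9:
  fixes k n p :: nat and j :: int
  assumes "prime p" and "[p = 2] (mod 3)" and "\<not> [j = 0] (mod int p)"
  shows "[B5 (int p ^ (2 * k + 2) * int n + int p ^ (2 * k + 1) * j
              + (int p ^ (2 * k + 2) - 1) div 3) = 0] (mod 5)"
proof -
  define A where "A = int p ^ (2 * k + 2) * int n + int p ^ (2 * k + 1) * j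
              + (int p ^ (2 * k + 2) - 1) div 3"
  have "[B5 A = 0] (mod 5)"
  \<comment> \<open>A negative \<open>j\<close> can make the argument negative, where
    \<open>B5\<close> is 0.\<close>
  proof (cases "A < 0")
    case False
    then obtain N where N: "A = int N" by (metis not_less nonneg_int_cases)
    have "[int p = 2] (mod 3)" using assms(2) by (metis cong_int_iff of_nat_numeral)
    hence "[int p ^ (2 * k + 2) = 2 ^ (2 * k + 2)] (mod 3)" by (rule cong_pow)
    also have "(2::int) ^ (2 * k + 2) = 4 ^ Suc k" by (simp add: power_mult)
    also have "[(4::int) ^ Suc k = 1 ^ Suc k] (mod 3)" by (intro cong_pow) (simp add: cong_def)
    \<comment> \<open>Hence the division by 3 in \<open>A\<close> is exact.\<close>
    finally have "3 dvd int p ^ (2 * k + 2) - 1" by (simp add: cong_iff_dvd_diff)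
    hence "3 * int N + 1 = 3 * int p ^ (2 * k + 2) * int n + 3 * int p ^ (2 * k + 1) * j + int p ^ (2 * k + 2)"
      unfolding N[symmetric] A_def by (auto simp: algebra_simps)
    \<comment> \<open>The second factor is prime to p, as p divides neither 3 nor \<open>j\<close>;
      so p occurs to the odd power 2 k + 1 exactly.\<close>
    hence eq: "3 * int N + 1 = int p ^ (2 * k + 1) * (int p * (3 * int n + 1) + 3 * j)"
      by (simp add: algebra_simps)
    have "3 * int N + 1 \<noteq> u\<^sup>2 - u * v + v\<^sup>2" for u v
    proof
      assume uv: "3 * int N + 1 = u\<^sup>2 - u * v + v\<^sup>2"
      have "int p ^ (2 * k + 1) dvd 3 * int N + 1" unfolding eq by simp
      hence "int p ^ (2 * k + 2) dvd 3 * int N + 1"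
        unfolding uv by (rule norm_form_odd_power_dvd[OF assms(1,2)])
      hence "int p ^ (2 * k + 1) * int p dvd int p ^ (2 * k + 1) * (int p * (3 * int n + 1) + 3 * j)"
        unfolding eq by (simp add: mult.commute)
      moreover have "int p \<noteq> 0" using assms(1) by (metis not_prime_0 of_nat_eq_0_iff)
      ultimately have "int p dvd int p * (3 * int n + 1) + 3 * j" by simp
      hence "int p dvd 3 * j" by (metis dvd_add_right_iff dvd_triv_left)
      hence "int p dvd 3 \<or> int p dvd j" using assms(1) by (simp add: prime_dvd_mult_iff)
      thus False using assms(3) not_dvd_three[OF assms(2)] by (simp add: cong_0_iff)
    qed
    hence "(euler_fps ^ 8) $ N = 0" by (rule euler_eighth_power_nth)
    hence "[int (B5 A) = int 0] (mod int 5)" using B5_cong[of N] by (simp add: N)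
    thus ?thesis by (simp only: cong_int_iff)
  qed (simp add: B5_neg)
  thus ?thesis unfolding A_def .
qed

end
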